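(* Let $F:\mathbb R^d\to\mathbb R$ be $L_0$-Lipschitz and $L_1$-smooth w.r.t. $\|\cdot\|_1$. Let $x^1,\dots,x^T\in\Delta_d$ be deterministic vectors and $a^1,\dots,a^T\in\Delta_d$ be random vectors such that $\mathbb E[a^t\mid a^{t-1},\dots,a^1]=x^t$ for every $t\in[T]$. Let $\bar x^T=\frac1T\sum_{t=1}^Tx^t$ and $\bar a^T=\frac1T\sum_{t=1}^Ta^t$. Then $$\mathbb E\big\|\nabla F(\bar a^T)-\nabla F(\bar x^T)\big\|_\infty^2\le\frac{8\sqrt2\,L_1^2}{T^{3/2}\sqrt{4+\log(d)}}+\frac{8\sqrt2\,(L_0^2+L_1^2)\sqrt{4+\log(d)}}{\sqrt T}.$$
   Context: $\Delta_d=\{x\in\mathbb R^d:x_j\ge0,\ \sum_jx_j=1\}$. A differentiable $F$ is $L_0$-Lipschitz w.r.t. $\|\cdot\|_1$ if $\|\nabla F(u)\|_\infty\le L_0$ for all $u$, and $L_1$-smooth w.r.t. $\|\cdot\|_1$ if $\|\nabla F(u)-\nabla F(u')\|_\infty\le L_1\|u-u'\|_1$ for all $u,u'$. $\log$ is the natural logarithm. *)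

theory Defs
  imports "HOL-Probability.Probability"
begin

definition prob_simplex :: "(real ^ 'd) set" where
  "prob_simplex = {x. (\<forall>j. 0 \<le> x $ j) \<and> (\<Sum>j\<in>UNIV. x $ j) = 1}"

definition l1_norm :: "real ^ 'd \<Rightarrow> real" where
  "l1_norm x = (\<Sum>j\<in>UNIV. \<bar>x $ j\<bar>)"

text \<open>Meaningful only where the function is differentiable.\<close>

definition gradient :: "(real ^ 'd \<Rightarrow> real) \<Rightarrow> real ^ 'd \<Rightarrow> real ^ 'd" where
  "gradient F u = (THE D. GDERIV F u :> D)"

lemma gradient_eqI:
  assumes "GDERIV F u :> D"
  shows "gradient F u = D"
  unfolding gradient_def
proof (rule the_equality)
  show "GDERIV F u :> D" by fact
next
  fix D' assume "GDERIV F u :> D'"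
  then have "(\<lambda>h. h \<bullet> D') = (\<lambda>h. h \<bullet> D)"
    using assms unfolding gderiv_def by (rule has_derivative_unique)
  then have "\<forall>h. h \<bullet> D' = h \<bullet> D" by metis
  then show "D' = D" by (simp add: vector_eq_ldot)
qed

lemma GDERIV_gradient:
  assumes "F differentiable (at u)"
  shows "GDERIV F u :> gradient F u"
proof -
  obtain F' where F': "(F has_derivative F') (at u)"
    using assms unfolding differentiable_def by blast
  then have lin: "linear F'" by (rule has_derivative_linear)
  have "F' h = h \<bullet> (\<Sum>b\<in>Basis. F' b *\<^sub>R b)" for h
  proof -
    have "F' h = F' (\<Sum>b\<in>Basis. (h \<bullet> b) *\<^sub>R b)"
      by (simp only: euclidean_representation)
    also have "\<dots> = (\<Sum>b\<in>Basis. (h \<bullet> b) * F' b)"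
      by (simp only: linear_sum[OF lin] linear_cmul[OF lin] real_scaleR_def)
    also have "\<dots> = h \<bullet> (\<Sum>b\<in>Basis. F' b *\<^sub>R b)"
      by (simp only: inner_sum_right inner_scaleR_right mult.commute)
    finally show ?thesis .
  qed
  then have "F' = (\<lambda>h. h \<bullet> (\<Sum>b\<in>Basis. F' b *\<^sub>R b))" by blast
  with F' have "GDERIV F u :> (\<Sum>b\<in>Basis. F' b *\<^sub>R b)"
    unfolding gderiv_def by simp
  then show ?thesis using gradient_eqI by metis
qed

text \<open>Lipschitz continuity and smoothness with respect to the $\ell_1$ norm, both
  stated through the dual norm \<^const>\<open>infnorm\<close>, which on \<^typ>\<open>real ^ 'd\<close> is the
  maximum of the absolute values of the coordinates.\<close>

definition l1_Lipschitz :: "real \<Rightarrow> (real ^ 'd \<Rightarrow> real) \<Rightarrow> bool" where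
  "l1_Lipschitz L F \<longleftrightarrow>
     (\<forall>u. F differentiable (at u)) \<and> (\<forall>u. infnorm (gradient F u) \<le> L)"

definition l1_smooth :: "real \<Rightarrow> (real ^ 'd \<Rightarrow> real) \<Rightarrow> bool" where
  "l1_smooth L F \<longleftrightarrow>
     (\<forall>u. F differentiable (at u)) \<and>
     (\<forall>u u'. infnorm (gradient F u - gradient F u') \<le> L * l1_norm (u - u'))"

text \<open>The \<open>\<sigma>\<close>-algebra generated by \<open>a 1, \<dots>, a (t - 1)\<close>; it is trivial for \<open>t = 1\<close>.
  It is not written as a supremum of \<^const>\<open>vimage_algebra\<close>s because the supremum
  of the empty family has empty space.\<close>

definition past_algebra ::
  "'w measure \<Rightarrow> (nat \<Rightarrow> 'w \<Rightarrow> real ^ 'd) \<Rightarrow> nat \<Rightarrow> 'w measure" where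
  "past_algebra M a t =
     sigma (space M) (\<Union>s\<in>{1..<t}. {a s -` B \<inter> space M | B. B \<in> sets borel})"

lemma subalgebra_past_algebra:
  assumes "\<And>s. s \<in> {1..<t} \<Longrightarrow> a s \<in> borel_measurable M"
  shows "subalgebra M (past_algebra M a t)"
proof -
  let ?G = "\<Union>s\<in>{1..<t}. {a s -` B \<inter> space M | B. B \<in> sets borel}"
  have G: "?G \<subseteq> sets M"
    using assms by (auto intro: measurable_sets)
  then have "?G \<subseteq> Pow (space M)"
    using sets.sets_into_space by blast
  with G show ?thesis
    unfolding subalgebra_def past_algebra_def
    by (simp add: sets.sigma_sets_subset)
qed

text \<open>The library's conditional expectation is real-valued; vectors are treated
  coordinatewise.\<close>

definition vec_cond_exp ::
  "'w measure \<Rightarrow> 'w measure \<Rightarrow> ('w \<Rightarrow> real ^ 'd) \<Rightarrow> 'w \<Rightarrow> real ^ 'd" where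
  "vec_cond_exp M G X \<omega> = (\<chi> j. real_cond_exp M G (\<lambda>\<omega>'. X \<omega>' $ j) \<omega>)"

definition average :: "nat \<Rightarrow> (nat \<Rightarrow> real ^ 'd) \<Rightarrow> real ^ 'd" where
  "average T y = (1 / real T) *\<^sub>R (\<Sum>t\<in>{1..T}. y t)"

end

theory Submission
  imports Defs
begin

text \<open>Up to an error of order \<open>L\<^sub>1 \<delta>\<close>, each partial derivative of \<open>F\<close> is the central difference
  quotient \<open>\<Phi> j u = (F (u + \<delta> e\<^sub>j) - F (u - \<delta> e\<^sub>j)) / (2 \<delta>)\<close>, whose gradient is bounded by \<open>L\<^sub>0 / \<delta>\<close>
  and which is \<open>L\<^sub>1 / \<delta>\<close>-smooth. Exchange \<open>x t\<close> for \<open>a t\<close> in the average, one \<open>t\<close> at a time: the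
  first-order parts of the changes of \<open>\<Phi> j\<close> are martingale differences bounded by
  \<open>2 L\<^sub>0 / (\<delta> T)\<close>, and the second-order parts sum to at most \<open>2 L\<^sub>1 / (\<delta> T)\<close>. By Azuma's inequality
  and a maximal inequality over the \<open>d\<close> coordinates, the largest squared martingale has
  expectation of order \<open>L\<^sub>0\<^sup>2 (4 + ln d) / (\<delta>\<^sup>2 T)\<close>. The choice
  \<open>\<delta>\<^sup>2 = 2 sqrt ((4 + ln d) / T)\<close> balances this against \<open>(L\<^sub>1 \<delta>)\<^sup>2\<close>.\<close>

section \<open>The l1 norm and its dual, the maximum norm\<close>

lemma infnorm_cart_attained:
  fixes z :: "real ^ 'd"
  obtains j where "infnorm z = \<bar>z $ j\<bar>"
proof -
  have "infnorm z \<in> (\<lambda>i. \<bar>z \<bullet> i\<bar>) ` Basis"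
    unfolding infnorm_Max by (rule Max_in) auto
  then obtain i where "i \<in> Basis" "infnorm z = \<bar>z \<bullet> i\<bar>" by blast
  moreover from this(1) obtain j where "i = axis j 1"
    by (auto simp: Basis_vec_def)
  ultimately show thesis using that by (simp add: inner_axis)
qed

lemma l1_norm_nonneg: "0 \<le> l1_norm h"
  by (simp add: l1_norm_def sum_nonneg)

lemma l1_norm_scaleR: "l1_norm (c *\<^sub>R h) = \<bar>c\<bar> * l1_norm h"
  by (simp add: l1_norm_def abs_mult sum_distrib_left)

lemma l1_norm_axis: "l1_norm (axis j c) = \<bar>c\<bar>"
  by (simp add: l1_norm_def axis_def if_distrib[of abs] cong: if_cong)

lemma l1_norm_le_norm: "l1_norm (h :: real ^ 'd) \<le> real CARD('d) * norm h"
  unfolding l1_norm_def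
  using sum_bounded_above[of UNIV "\<lambda>j. \<bar>h $ j\<bar>" "norm h"] component_le_norm_cart[of h]
  by simp

lemma l1_norm_diff_simplex:
  assumes "u \<in> prob_simplex" "v \<in> prob_simplex"
  shows "l1_norm (u - v) \<le> 2"
proof -
  have "l1_norm (u - v) \<le> (\<Sum>j\<in>UNIV. u $ j + v $ j)"
    unfolding l1_norm_def using assms by (intro sum_mono) (auto simp: prob_simplex_def abs_le_iff)
  also have "\<dots> = 2"
    using assms by (simp add: sum.distrib prob_simplex_def)
  finally show ?thesis .
qed

text \<open>Hoelder's inequality for the exponents infinity and 1; it turns bounds on gradients into
  bounds on increments.\<close>

lemma inner_le_infnorm_l1_norm: "\<bar>g \<bullet> h\<bar> \<le> infnorm g * l1_norm h"
  for g h :: "real ^ 'd"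
proof -
  have "\<bar>g \<bullet> h\<bar> \<le> (\<Sum>j\<in>UNIV. \<bar>g $ j\<bar> * \<bar>h $ j\<bar>)"
    unfolding inner_vec_def by (rule order_trans[OF sum_abs]) (simp add: abs_mult)
  also have "\<dots> \<le> (\<Sum>j\<in>UNIV. infnorm g * \<bar>h $ j\<bar>)"
    by (intro sum_mono mult_right_mono component_le_infnorm_cart) auto
  finally show ?thesis by (simp add: l1_norm_def sum_distrib_left)
qed

section \<open>Smoothness: continuity of the gradient and second-order Taylor bounds\<close>

lemma l1_smooth_nonneg:
  fixes F :: "real ^ 'd \<Rightarrow> real"
  assumes "l1_smooth L F"
  shows "0 \<le> L"
proof -
  \<comment> \<open>Some coordinate exists, so \<open>axis j 1\<close> and 0 are points at l1
    distance 1, and \<open>L\<close> bounds a norm from above.\<close>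
  fix j :: 'd
  have "infnorm (gradient F (axis j 1) - gradient F 0) \<le> L * l1_norm (axis j 1 - 0 :: real ^ 'd)"
    using assms unfolding l1_smooth_def by blast
  then show ?thesis
    using infnorm_pos_le[of "gradient F (axis j 1) - gradient F 0"] by (simp add: l1_norm_axis)
qed

text \<open>Comparing both norms with the Euclidean one gives an ordinary Lipschitz bound.
  Continuity later makes gradients at random points measurable.\<close>

lemma l1_smooth_continuous_gradient:
  fixes F :: "real ^ 'd \<Rightarrow> real"
  assumes "l1_smooth L F"
  shows "continuous_on UNIV (gradient F)"
proof -
  have L: "0 \<le> L" using assms by (rule l1_smooth_nonneg)
  define C where "C = sqrt DIM(real ^ 'd) * (L * real CARD('d))"
  have "C-lipschitz_on UNIV (gradient F)"
  proof (rule lipschitz_onI)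
    fix u v :: "real ^ 'd"
    have "norm (gradient F u - gradient F v) \<le> sqrt DIM(real ^ 'd) * infnorm (gradient F u - gradient F v)"
      by (rule norm_le_infnorm)
    also have "infnorm (gradient F u - gradient F v) \<le> L * l1_norm (u - v)"
      using assms unfolding l1_smooth_def by blast
    also have "\<dots> \<le> L * (real CARD('d) * norm (u - v))"
      by (intro mult_left_mono l1_norm_le_norm L)
    finally show "dist (gradient F u) (gradient F v) \<le> C * dist u v"
      by (simp add: C_def dist_norm mult.assoc)
  qed (use L in \<open>simp add: C_def\<close>)
  then show ?thesis by (rule lipschitz_on_continuous_on)
qed

text \<open>On the segment from \<open>u\<close> to \<open>u + h\<close> the slope at parameter
  \<open>r\<close> differs from the initial slope by at most \<open>L * r\<close> times the squared
  l1 norm of \<open>h\<close>; integrating over \<open>r\<close> produces the factor 1/2. The sign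
  \<open>s\<close> treats the upper and the lower bound at once.\<close>

lemma l1_smooth_taylor_upper:
  fixes F :: "real ^ 'd \<Rightarrow> real"
  assumes F: "l1_smooth L F" and s: "\<bar>s\<bar> = 1"
  shows "s * (F (u + h) - F u - gradient F u \<bullet> h) \<le> L / 2 * (l1_norm h)\<^sup>2"
proof -
  \<comment> \<open>Chosen so that the claim reads \<open>\<psi> 1 \<le> \<psi> 0\<close>;
    monotonicity of \<open>\<psi>\<close> replaces integration of the gradient.\<close>
  define \<psi> where "\<psi> r = s * (F (u + r *\<^sub>R h) - r * (gradient F u \<bullet> h)) - L / 2 * (l1_norm h)\<^sup>2 * r\<^sup>2" for r
  define \<psi>' where "\<psi>' r = s * ((gradient F (u + r *\<^sub>R h) - gradient F u) \<bullet> h) - L * (l1_norm h)\<^sup>2 * r" for r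
  have "\<psi> 1 \<le> \<psi> 0"
  proof (rule DERIV_nonpos_imp_nonincreasing[where f = \<psi>])
    fix r :: real assume r: "0 \<le> r" "r \<le> 1"
    have "F differentiable (at (u + r *\<^sub>R h))"
      using F by (simp add: l1_smooth_def)
    from GDERIV_gradient[OF this]
    have "((\<lambda>r. F (u + r *\<^sub>R h)) has_derivative (\<lambda>q. (q *\<^sub>R h) \<bullet> gradient F (u + r *\<^sub>R h))) (at r)"
      unfolding gderiv_def by (rule has_derivative_compose[rotated]) (auto intro!: derivative_eq_intros)
    then have [derivative_intros]: "((\<lambda>r. F (u + r *\<^sub>R h)) has_real_derivative gradient F (u + r *\<^sub>R h) \<bullet> h) (at r)"
      by (rule has_derivative_imp_has_field_derivative) (simp add: inner_commute)
    have "(\<psi> has_real_derivative \<psi>' r) (at r)"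
      unfolding \<psi>_def \<psi>'_def by (auto intro!: derivative_eq_intros simp: inner_diff_left)
    moreover have "\<psi>' r \<le> 0"
    proof -
      have "s * ((gradient F (u + r *\<^sub>R h) - gradient F u) \<bullet> h)
          \<le> \<bar>(gradient F (u + r *\<^sub>R h) - gradient F u) \<bullet> h\<bar>"
        using s by (metis abs_ge_self abs_mult mult_1)
      also have "\<dots> \<le> infnorm (gradient F (u + r *\<^sub>R h) - gradient F u) * l1_norm h"
        by (rule inner_le_infnorm_l1_norm)
      also have "\<dots> \<le> L * l1_norm (u + r *\<^sub>R h - u) * l1_norm h"
        using F unfolding l1_smooth_def by (intro mult_right_mono l1_norm_nonneg) blast
      also have "\<dots> = L * (l1_norm h)\<^sup>2 * r"
        using r by (simp add: l1_norm_scaleR power2_eq_square)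
      finally show ?thesis by (simp add: \<psi>'_def)
    qed
    ultimately show "\<exists>y. (\<psi> has_real_derivative y) (at r) \<and> y \<le> 0" by blast
  qed simp
  then show ?thesis by (simp add: \<psi>_def algebra_simps)
qed

lemma l1_smooth_taylor:
  fixes F :: "real ^ 'd \<Rightarrow> real"
  assumes "l1_smooth L F"
  shows "\<bar>F (u + h) - F u - gradient F u \<bullet> h\<bar> \<le> L / 2 * (l1_norm h)\<^sup>2"
  using l1_smooth_taylor_upper[OF assms, of 1 u h] l1_smooth_taylor_upper[OF assms, of "-1" u h]
  by (intro abs_leI) simp_all

section \<open>Azuma's inequality as a bound on exponential moments\<close>

text \<open>Hoeffding's lemma for a fair sign: with step \<open>2 * y\<close> and probability 1/2,
  the logarithm in the auxiliary estimate is \<open>y + ln (cosh y)\<close>. Negative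
  \<open>y\<close> follow by evenness.\<close>

lemma cosh_le_exp_half_square: "cosh y \<le> exp (y\<^sup>2 / 2)" for y :: real
proof -
  have *: "cosh y \<le> exp (y\<^sup>2 / 2)" if "0 \<le> y" for y :: real
  proof -
    have "1 + 1 / 2 * (exp (2 * y) - 1) = exp y * cosh y"
      by (simp add: cosh_field_def field_simps flip: exp_add)
    then have "ln (cosh y) \<le> y\<^sup>2 / 2"
      using Hoeffdings_lemma_aux[of "2 * y" "1 / 2"] that by (simp add: ln_mult power_mult_distrib)
    then show ?thesis by (metis cosh_real_pos exp_le_cancel_iff exp_ln)
  qed
  show ?thesis using *[of y] *[of "- y"] by (cases "0 \<le> y") auto
qed

text \<open>By convexity the exponential lies below its chord over \<open>[-b, b]\<close>. The chord
  is affine in \<open>z\<close>, so its \<open>sinh\<close> term vanishes in expectation against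
  martingale differences.\<close>

lemma exp_le_chord:
  fixes b z \<theta> :: real
  assumes b: "0 < b" and z: "\<bar>z\<bar> \<le> b"
  shows "exp (\<theta> * z) \<le> cosh (\<theta> * b) + sinh (\<theta> * b) / b * z"
proof -
  define t where "t = (1 - z / b) / 2"
  have t: "0 \<le> t" "t \<le> 1" using assms by (auto simp: t_def field_simps abs_le_iff)
  have "exp ((1 - t) *\<^sub>R (\<theta> * b) + t *\<^sub>R (- (\<theta> * b))) \<le> (1 - t) * exp (\<theta> * b) + t * exp (- (\<theta> * b))"
    using t by (intro convex_onD[OF exp_convex]) auto
  moreover have "(1 - t) *\<^sub>R (\<theta> * b) + t *\<^sub>R (- (\<theta> * b)) = \<theta> * z"
    using b by (simp add: t_def field_simps)
  moreover have "(1 - t) * exp (\<theta> * b) + t * exp (- (\<theta> * b)) = cosh (\<theta> * b) + sinh (\<theta> * b) / b * z"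
    using b by (simp add: t_def cosh_field_def sinh_field_def field_simps)
  ultimately show ?thesis by simp
qed

lemma (in prob_space) integrable_bounded:
  fixes f :: "'a \<Rightarrow> real"
  assumes "f \<in> borel_measurable M" "\<And>\<omega>. \<omega> \<in> space M \<Longrightarrow> \<bar>f \<omega>\<bar> \<le> B"
  shows "integrable M f"
  using assms by (intro integrable_const_bound[of _ B]) auto

lemma borel_measurable_vec_component [measurable (raw)]:
  fixes V :: "'a \<Rightarrow> real ^ 'd"
  assumes "V \<in> borel_measurable N"
  shows "(\<lambda>\<omega>. V \<omega> $ j) \<in> borel_measurable N"
  using borel_measurable_inner[OF assms measurable_const, of "axis j 1"] by (simp add: inner_axis)

text \<open>Induction on the number of increments: the chord bound for the last one leaves a factor
  \<open>cosh (\<theta> * b)\<close>, at most \<open>exp ((\<theta> * b)\<^sup>2 / 2)\<close>. The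
  assumption \<open>orth\<close> is the martingale property in the form consumed here, orthogonality
  of each increment to the exponential of the preceding partial sum.\<close>

lemma (in prob_space) azuma_mgf:
  fixes X :: "nat \<Rightarrow> 'a \<Rightarrow> real"
  assumes meas: "\<And>t. t \<in> {1..n} \<Longrightarrow> X t \<in> borel_measurable M"
    and bound: "\<And>t \<omega>. t \<in> {1..n} \<Longrightarrow> \<omega> \<in> space M \<Longrightarrow> \<bar>X t \<omega>\<bar> \<le> b"
    and orth: "\<And>t. t \<in> {1..n} \<Longrightarrow> expectation (\<lambda>\<omega>. exp (\<theta> * (\<Sum>s\<in>{1..<t}. X s \<omega>)) * X t \<omega>) = 0"
    and b: "0 < b"
  shows "expectation (\<lambda>\<omega>. exp (\<theta> * (\<Sum>t\<in>{1..n}. X t \<omega>))) \<le> exp (\<theta>\<^sup>2 * (real n * b\<^sup>2) / 2)"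
  using meas bound orth
proof (induction n)
  case 0
  then show ?case by (simp add: prob_space)
next
  case (Suc n)
  define Z where "Z \<omega> = exp (\<theta> * (\<Sum>t\<in>{1..n}. X t \<omega>))" for \<omega>
  have [measurable]: "X t \<in> borel_measurable M" if "t \<in> {1..Suc n}" for t
    using Suc.prems(1) that by blast
  have Zm [measurable]: "Z \<in> borel_measurable M"
    unfolding Z_def by measurable
  have Zb: "\<bar>Z \<omega>\<bar> \<le> exp (\<bar>\<theta>\<bar> * (real n * b))" if "\<omega> \<in> space M" for \<omega>
  proof -
    have "\<bar>\<Sum>t\<in>{1..n}. X t \<omega>\<bar> \<le> (\<Sum>t\<in>{1..n}. b)"
      by (rule order_trans[OF sum_abs sum_mono]) (use Suc.prems(2) that in auto)
    then have "\<bar>\<theta>\<bar> * \<bar>\<Sum>t\<in>{1..n}. X t \<omega>\<bar> \<le> \<bar>\<theta>\<bar> * (real n * b)"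
      by (intro mult_left_mono) auto
    then show ?thesis
      unfolding Z_def by (simp flip: abs_mult)
  qed
  have iZ: "integrable M Z" by (rule integrable_bounded[OF Zm Zb])
  have Xm: "X (Suc n) \<in> borel_measurable M" by simp
  have iZX: "integrable M (\<lambda>\<omega>. Z \<omega> * X (Suc n) \<omega>)"
  proof (rule integrable_bounded)
    show "(\<lambda>\<omega>. Z \<omega> * X (Suc n) \<omega>) \<in> borel_measurable M"
      using Xm by simp
    show "\<bar>Z \<omega> * X (Suc n) \<omega>\<bar> \<le> exp (\<bar>\<theta>\<bar> * (real n * b)) * b" if "\<omega> \<in> space M" for \<omega>
      unfolding abs_mult by (intro mult_mono Zb Suc.prems(2) that) auto
  qed
  \<comment> \<open>\<open>{1..<Suc n}\<close> is \<open>{1..n}\<close>, so the weight in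
    \<open>orth\<close> at \<open>Suc n\<close> is exactly \<open>Z\<close>.\<close>
  have ZX0: "expectation (\<lambda>\<omega>. Z \<omega> * X (Suc n) \<omega>) = 0"
    using Suc.prems(3)[of "Suc n"] by (simp add: Z_def atLeastLessThanSuc_atLeastAtMost)
  have "expectation (\<lambda>\<omega>. exp (\<theta> * (\<Sum>t\<in>{1..Suc n}. X t \<omega>)))
      \<le> expectation (\<lambda>\<omega>. cosh (\<theta> * b) * Z \<omega> + sinh (\<theta> * b) / b * (Z \<omega> * X (Suc n) \<omega>))"
  proof (rule integral_mono')
    fix \<omega> assume \<omega>: "\<omega> \<in> space M"
    have "exp (\<theta> * (\<Sum>t\<in>{1..Suc n}. X t \<omega>)) = Z \<omega> * exp (\<theta> * X (Suc n) \<omega>)"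
      by (simp add: Z_def distrib_left exp_add)
    also have "\<dots> \<le> Z \<omega> * (cosh (\<theta> * b) + sinh (\<theta> * b) / b * X (Suc n) \<omega>)"
      using Suc.prems(2)[of "Suc n" \<omega>] \<omega> b by (intro mult_left_mono exp_le_chord) (auto simp: Z_def)
    finally show *: "exp (\<theta> * (\<Sum>t\<in>{1..Suc n}. X t \<omega>))
        \<le> cosh (\<theta> * b) * Z \<omega> + sinh (\<theta> * b) / b * (Z \<omega> * X (Suc n) \<omega>)"
      by (simp add: algebra_simps)
    show "0 \<le> cosh (\<theta> * b) * Z \<omega> + sinh (\<theta> * b) / b * (Z \<omega> * X (Suc n) \<omega>)"
      using * by (rule order_trans[rotated]) simp
  qed (intro Bochner_Integration.integrable_add integrable_mult_right iZ iZX)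
  also have "\<dots> = cosh (\<theta> * b) * expectation Z"
    using iZ iZX ZX0 by simp
  also have "\<dots> \<le> exp ((\<theta> * b)\<^sup>2 / 2) * exp (\<theta>\<^sup>2 * (real n * b\<^sup>2) / 2)"
    using Suc.IH Suc.prems unfolding Z_def
    by (intro mult_mono cosh_le_exp_half_square) auto
  also have "\<dots> = exp (\<theta>\<^sup>2 * (real (Suc n) * b\<^sup>2) / 2)"
    by (simp add: power_mult_distrib field_simps flip: exp_add)
  finally show ?case .
qed

section \<open>A maximal inequality for squares of sub-Gaussian variables\<close>

text \<open>Converts a second moment into an exponential one: up to the threshold \<open>s\<close>
  the square costs \<open>s\<^sup>2\<close>, and beyond it the excess is polynomial in
  \<open>w = \<theta> * (\<bar>y\<bar> - s)\<close>, hence dominated by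
  \<open>exp w\<close>.\<close>

lemma square_le_exp_shift:
  fixes s \<theta> y :: real
  assumes "0 < \<theta>" "0 \<le> s"
  shows "\<bar>y\<bar>\<^sup>2 \<le> s\<^sup>2 + (2 * s / \<theta> + 2 / \<theta>\<^sup>2) * exp (\<theta> * (\<bar>y\<bar> - s))"
proof (cases "\<bar>y\<bar> \<le> s")
  case True
  then have "\<bar>y\<bar>\<^sup>2 \<le> s\<^sup>2" by (intro power_mono) auto
  then show ?thesis using assms by (intro order_trans[OF _ add_increasing2]) auto
next
  case False
  define w where "w = \<theta> * (\<bar>y\<bar> - s)"
  have w: "0 \<le> w" using False assms by (simp add: w_def)
  have y: "\<bar>y\<bar> = s + w / \<theta>" using assms by (simp add: w_def)
  have "w \<le> exp w" "w\<^sup>2 \<le> 2 * exp w"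
    using exp_lower_Taylor_quadratic[OF w] w zero_le_power2[of w] by linarith+
  then have "2 * s / \<theta> * w + 1 / \<theta>\<^sup>2 * w\<^sup>2 \<le> 2 * s / \<theta> * exp w + 1 / \<theta>\<^sup>2 * (2 * exp w)"
    using assms by (intro add_mono mult_left_mono) auto
  then show ?thesis
    unfolding w_def[symmetric] unfolding y by (simp add: power2_sum power_divide algebra_simps)
qed

text \<open>The maximum is attained by one index, whose shifted exponential is bounded by the sum
  over all indices and both signs. The threshold \<open>s\<close> is high enough for this sum to
  have expectation at most 1 after the shift, which leaves \<open>s\<^sup>2 + K\<close>.\<close>

lemma (in prob_space) expectation_Max_square_le:
  fixes Y :: "'j \<Rightarrow> 'a \<Rightarrow> real"
  assumes J: "finite J" "J \<noteq> {}"
    and meas: "\<And>j. j \<in> J \<Longrightarrow> Y j \<in> borel_measurable M"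
    and bound: "\<And>j \<omega>. j \<in> J \<Longrightarrow> \<omega> \<in> space M \<Longrightarrow> \<bar>Y j \<omega>\<bar> \<le> B"
    and mgf: "\<And>j \<theta>. j \<in> J \<Longrightarrow> expectation (\<lambda>\<omega>. exp (\<theta> * Y j \<omega>)) \<le> exp (\<theta>\<^sup>2 * v / 2)"
    and v: "0 < v"
  shows "expectation (\<lambda>\<omega>. MAX j\<in>J. (Y j \<omega>)\<^sup>2) \<le> 2 * v * (4 + ln (card J))"
proof -
  define N where "N = real (card J)"
  have N: "1 \<le> N" using J by (simp add: N_def Suc_le_eq card_gt_0_iff)
  \<comment> \<open>With this \<open>\<theta>\<close> each exponential moment is at most
    \<open>2 * N\<close>, so the \<open>2 * N\<close> of them total at most
    \<open>(2 * N)\<^sup>2\<close>; \<open>s = \<theta> * v\<close> makes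
    \<open>exp (- \<theta> * s)\<close> the reciprocal of that.\<close>
  define \<theta> where "\<theta> = sqrt (2 * ln (2 * N) / v)"
  define s where "s = \<theta> * v"
  define K where "K = 2 * s / \<theta> + 2 / \<theta>\<^sup>2"
  \<comment> \<open>The 2 inside the logarithm, which counts the two signs, keeps
    \<open>\<theta>\<close> positive even when \<open>N = 1\<close>.\<close>
  have l2: "2 / 3 \<le> ln (2 * N)"
    using ln2_ge_two_thirds ln_mono[of 2 "2 * N"] N by linarith
  have \<theta>: "0 < \<theta>" "\<theta>\<^sup>2 = 2 * ln (2 * N) / v"
    using l2 v by (auto simp: \<theta>_def)
  have s: "0 \<le> s" using \<theta> v by (simp add: s_def)
  have K: "0 \<le> K" using \<theta>(1) s by (simp add: K_def)
  have ie: "integrable M (\<lambda>\<omega>. exp (\<eta> * Y j \<omega>))" if j: "j \<in> J" for j \<eta>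
  proof (rule integrable_bounded)
    show "(\<lambda>\<omega>. exp (\<eta> * Y j \<omega>)) \<in> borel_measurable M"
      using meas[OF j] by measurable
    show "\<bar>exp (\<eta> * Y j \<omega>)\<bar> \<le> exp (\<bar>\<eta>\<bar> * B)" if "\<omega> \<in> space M" for \<omega>
      using abs_ge_self[of "\<eta> * Y j \<omega>"] mult_left_mono[OF bound[OF j that], of "\<bar>\<eta>\<bar>"]
      by (simp add: abs_mult)
  qed
  have "expectation (\<lambda>\<omega>. MAX j\<in>J. (Y j \<omega>)\<^sup>2)
      \<le> expectation (\<lambda>\<omega>. s\<^sup>2 + K * exp (- \<theta> * s) * (\<Sum>j\<in>J. exp (\<theta> * Y j \<omega>) + exp (- \<theta> * Y j \<omega>)))"
  proof (rule integral_mono')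
    fix \<omega> assume "\<omega> \<in> space M"
    have "(MAX j\<in>J. (Y j \<omega>)\<^sup>2) \<in> (\<lambda>j. (Y j \<omega>)\<^sup>2) ` J"
      using J by (intro Max_in) auto
    then obtain i where i: "i \<in> J" "(MAX j\<in>J. (Y j \<omega>)\<^sup>2) = \<bar>Y i \<omega>\<bar>\<^sup>2" by auto
    have "exp (\<theta> * \<bar>Y i \<omega>\<bar>) \<le> exp (\<theta> * Y i \<omega>) + exp (- \<theta> * Y i \<omega>)"
      by (cases "0 \<le> Y i \<omega>") auto
    also have "\<dots> \<le> (\<Sum>j\<in>J. exp (\<theta> * Y j \<omega>) + exp (- \<theta> * Y j \<omega>))"
      using J i(1) by (intro member_le_sum) auto
    finally have "K * exp (- \<theta> * s) * exp (\<theta> * \<bar>Y i \<omega>\<bar>)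
        \<le> K * exp (- \<theta> * s) * (\<Sum>j\<in>J. exp (\<theta> * Y j \<omega>) + exp (- \<theta> * Y j \<omega>))"
      using K by (intro mult_left_mono) auto
    moreover have "\<bar>Y i \<omega>\<bar>\<^sup>2 \<le> s\<^sup>2 + K * exp (\<theta> * (\<bar>Y i \<omega>\<bar> - s))"
      unfolding K_def by (rule square_le_exp_shift[OF \<theta>(1) s])
    moreover have "exp (\<theta> * (\<bar>Y i \<omega>\<bar> - s)) = exp (- \<theta> * s) * exp (\<theta> * \<bar>Y i \<omega>\<bar>)"
      by (simp add: algebra_simps flip: exp_add)
    ultimately show "(MAX j\<in>J. (Y j \<omega>)\<^sup>2)
        \<le> s\<^sup>2 + K * exp (- \<theta> * s) * (\<Sum>j\<in>J. exp (\<theta> * Y j \<omega>) + exp (- \<theta> * Y j \<omega>))"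
      unfolding i(2) by (simp only: mult.assoc)
  qed (use K in \<open>auto intro!: add_nonneg_nonneg mult_nonneg_nonneg sum_nonneg Bochner_Integration.integrable_add
       integrable_mult_right Bochner_Integration.integrable_sum
       ie ie[of _ "- \<theta>", simplified]\<close>)
  also have "\<dots> = s\<^sup>2 + K * exp (- \<theta> * s) *
      (\<Sum>j\<in>J. expectation (\<lambda>\<omega>. exp (\<theta> * Y j \<omega>)) + expectation (\<lambda>\<omega>. exp (- \<theta> * Y j \<omega>)))"
  proof -
    have 1: "integrable M (\<lambda>\<omega>. exp (\<theta> * Y j \<omega>) + exp (- \<theta> * Y j \<omega>))" if "j \<in> J" for j
      by (intro Bochner_Integration.integrable_add ie that)
    show ?thesis
      using 1 by (subst Bochner_Integration.integral_add)
        (auto simp: prob_space Bochner_Integration.integral_sum Bochner_Integration.integral_add ie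
         ie[of _ "- \<theta>", simplified] simp del: mult_minus_left intro!: sum.cong)
  qed
  also have "\<dots> \<le> s\<^sup>2 + K * exp (- \<theta> * s) * (\<Sum>j\<in>J. exp (\<theta>\<^sup>2 * v / 2) + exp ((- \<theta>)\<^sup>2 * v / 2))"
    using K by (intro add_left_mono mult_left_mono sum_mono add_mono mgf) auto
  also have "\<dots> = s\<^sup>2 + K"
  proof -
    have 1: "\<theta> * s = 2 * ln (2 * N)" "\<theta>\<^sup>2 * v / 2 = ln (2 * N)"
      using \<theta>(2) v by (simp_all add: s_def power2_eq_square[symmetric] mult.assoc[symmetric])
    have "(\<Sum>j\<in>J. exp (\<theta>\<^sup>2 * v / 2) + exp ((- \<theta>)\<^sup>2 * v / 2)) = 2 * N * (2 * N)"
      unfolding power2_minus 1 using N by (simp add: N_def)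
    moreover have "exp (- \<theta> * s) = 1 / (2 * N * (2 * N))"
      using 1(1) N by (simp add: exp_minus exp_double power2_eq_square field_simps)
    ultimately show ?thesis using N by simp
  qed
  also have "\<dots> = v * (2 * ln (2 * N) + 2 + 1 / ln (2 * N))"
  proof -
    have "s\<^sup>2 = v * (2 * ln (2 * N))"
      unfolding s_def power_mult_distrib \<theta>(2) using v by (simp add: power2_eq_square)
    moreover have "2 * s / \<theta> = 2 * v" using \<theta>(1) by (simp add: s_def)
    moreover have "2 / \<theta>\<^sup>2 = v / ln (2 * N)" using \<theta>(2) v l2 by simp
    ultimately show ?thesis by (simp add: K_def algebra_simps)
  qed
  also have "\<dots> \<le> v * (2 * (4 + ln N))"
  proof (intro mult_left_mono)
    \<comment> \<open>The constants add up to at most \<open>2 + 2 + 3 / 2\<close>, which is below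
      8.\<close>
    have "1 / ln (2 * N) \<le> 3 / 2" using l2 by (simp add: field_simps)
    moreover have "ln (2 * N) = ln 2 + ln N" using N by (simp add: ln_mult)
    moreover have "ln (2 :: real) \<le> 1" using ln_le_minus_one[of "2 :: real"] by simp
    ultimately show "2 * ln (2 * N) + 2 + 1 / ln (2 * N) \<le> 2 * (4 + ln N)"
      by argo
  qed (use v in simp)
  finally show ?thesis by (simp only: N_def mult.assoc mult.left_commute[of v])
qed

lemma (in prob_space) integrable_Max_square:
  fixes Y :: "'j \<Rightarrow> 'a \<Rightarrow> real"
  assumes J: "finite J" "J \<noteq> {}"
    and meas: "\<And>j. j \<in> J \<Longrightarrow> Y j \<in> borel_measurable M"
    and bound: "\<And>j \<omega>. j \<in> J \<Longrightarrow> \<omega> \<in> space M \<Longrightarrow> \<bar>Y j \<omega>\<bar> \<le> B"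
  shows "integrable M (\<lambda>\<omega>. MAX j\<in>J. (Y j \<omega>)\<^sup>2)"
proof (rule integrable_bounded)
  show "(\<lambda>\<omega>. MAX j\<in>J. (Y j \<omega>)\<^sup>2) \<in> borel_measurable M"
    by (intro borel_measurable_Max borel_measurable_power meas J)
  fix \<omega> assume \<omega>: "\<omega> \<in> space M"
  have "(MAX j\<in>J. (Y j \<omega>)\<^sup>2) \<in> (\<lambda>j. (Y j \<omega>)\<^sup>2) ` J"
    using J by (intro Max_in) auto
  then obtain i where i: "i \<in> J" "(MAX j\<in>J. (Y j \<omega>)\<^sup>2) = \<bar>Y i \<omega>\<bar>\<^sup>2" by auto
  show "\<bar>MAX j\<in>J. (Y j \<omega>)\<^sup>2\<bar> \<le> B\<^sup>2"
    unfolding i(2) using power_mono[OF bound[OF i(1) \<omega>], of 2] by simp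
qed

section \<open>Replacing \<open>x t\<close> by \<open>a t\<close> one index at a time, and the
  resulting martingale differences\<close>

locale simplex_martingale = prob_space M for M :: "'w measure" +
  fixes T :: nat and x :: "nat \<Rightarrow> real ^ 'd" and a :: "nat \<Rightarrow> 'w \<Rightarrow> real ^ 'd"
  assumes T_pos: "1 \<le> T"
    and x_simplex: "\<And>t. t \<in> {1..T} \<Longrightarrow> x t \<in> prob_simplex"
    and a_measurable: "\<And>t. t \<in> {1..T} \<Longrightarrow> a t \<in> borel_measurable M"
    and a_simplex: "\<And>t \<omega>. t \<in> {1..T} \<Longrightarrow> \<omega> \<in> space M \<Longrightarrow> a t \<omega> \<in> prob_simplex"
    and a_cond_exp: "\<And>t. t \<in> {1..T} \<Longrightarrow>
           AE \<omega> in M. vec_cond_exp M (past_algebra M a t) (a t) \<omega> = x t"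
begin

text \<open>The interpolation path of Lindeberg's replacement argument, from the average of
  \<open>x\<close> to that of \<open>a\<close>. The point \<open>hybrid (t - 1)\<close> is
  determined by the past of \<open>t\<close>, so a gradient may be evaluated there without spoiling
  the martingale property.\<close>

definition hybrid :: "nat \<Rightarrow> 'w \<Rightarrow> real ^ 'd" where
  "hybrid k \<omega> = average T (\<lambda>s. if s \<le> k then a s \<omega> else x s)"

lemma hybrid_0: "hybrid 0 \<omega> = average T x"
  unfolding hybrid_def average_def by (intro arg_cong[where f = "(*\<^sub>R) _"] sum.cong) auto

lemma hybrid_T: "hybrid T \<omega> = average T (\<lambda>t. a t \<omega>)"
  unfolding hybrid_def average_def by (intro arg_cong[where f = "(*\<^sub>R) _"] sum.cong) auto

lemma hybrid_step:
  assumes t: "t \<in> {1..T}"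
  shows "hybrid t \<omega> = hybrid (t - 1) \<omega> + (1 / real T) *\<^sub>R (a t \<omega> - x t)"
proof -
  \<comment> \<open>The two interpolants differ only in slot \<open>t\<close>; since
    \<open>t\<close> is at least 1, the truncated subtraction \<open>t - 1\<close> is exact.\<close>
  have "(\<Sum>s\<in>{1..T}. (if s \<le> t then a s \<omega> else x s) - (if s \<le> t - 1 then a s \<omega> else x s))
      = (\<Sum>s\<in>{1..T}. if s = t then a t \<omega> - x t else 0)"
    using t by (intro sum.cong) auto
  also have "\<dots> = a t \<omega> - x t" using t by simp
  finally have "(\<Sum>s\<in>{1..T}. if s \<le> t then a s \<omega> else x s)
      = (\<Sum>s\<in>{1..T}. if s \<le> t - 1 then a s \<omega> else x s) + (a t \<omega> - x t)"
    by (simp add: sum_subtractf algebra_simps)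
  then show ?thesis by (simp add: hybrid_def average_def scaleR_add_right)
qed

lemma past_subalgebra: "t \<in> {1..T} \<Longrightarrow> subalgebra M (past_algebra M a t)"
  using a_measurable by (intro subalgebra_past_algebra) auto

lemma a_measurable_past:
  assumes "s \<in> {1..<t}"
  shows "a s \<in> borel_measurable (past_algebra M a t)"
proof -
  \<comment> \<open>A family not contained in the power set would make \<open>sigma\<close> default
    to the trivial algebra.\<close>
  have sp: "(\<Union>s\<in>{1..<t}. {a s -` B \<inter> space M | B. B \<in> sets borel}) \<subseteq> Pow (space M)" by auto
  show ?thesis
    unfolding past_algebra_def
    by (rule measurableI) (use sp assms in \<open>auto simp: space_measure_of_conv intro!: sigma_sets.Basic bexI[of _ s] exI\<close>)
qed

lemma hybrid_measurable_past: "k < t \<Longrightarrow> hybrid k \<in> borel_measurable (past_algebra M a t)"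
proof -
  assume k: "k < t"
  have "(\<lambda>\<omega>. if s \<le> k then a s \<omega> else x s) \<in> borel_measurable (past_algebra M a t)" if "s \<in> {1..T}" for s
    using a_measurable_past[of s t] k that by (cases "s \<le> k") auto
  then show ?thesis unfolding hybrid_def average_def by measurable
qed

text \<open>Pull-out property, coordinate by coordinate: a factor known from the past moves through
  the conditional expectation, where \<open>a t\<close> becomes \<open>x t\<close>. Boundedness of
  \<open>V\<close> and of the simplex supplies integrability.\<close>

lemma past_inner_orthogonal:
  assumes t: "t \<in> {1..T}"
    and V: "V \<in> borel_measurable (past_algebra M a t)"
    and bound: "\<And>\<omega>. \<omega> \<in> space M \<Longrightarrow> infnorm (V \<omega>) \<le> B"
  shows "expectation (\<lambda>\<omega>. V \<omega> \<bullet> (a t \<omega> - x t)) = 0"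
proof -
  let ?N = "past_algebra M a t"
  interpret N: finite_measure_subalgebra M ?N
    by unfold_locales (rule past_subalgebra[OF t])
  have Vj: "(\<lambda>\<omega>. V \<omega> $ j) \<in> borel_measurable ?N" for j
    using V by measurable
  then have VjM [measurable]: "(\<lambda>\<omega>. V \<omega> $ j) \<in> borel_measurable M" for j
    using measurable_from_subalg[OF past_subalgebra[OF t]] by blast
  have [measurable]: "a t \<in> borel_measurable M" by (rule a_measurable[OF t])
  have Vb: "\<bar>V \<omega> $ j\<bar> \<le> B" if "\<omega> \<in> space M" for \<omega> j
    using component_le_infnorm_cart bound[OF that] order_trans by blast
  have ab: "\<bar>a t \<omega> $ j\<bar> \<le> 1" if "\<omega> \<in> space M" for \<omega> j
    using a_simplex[OF t that] member_le_sum[of j UNIV "\<lambda>j. a t \<omega> $ j"] by (auto simp: prob_simplex_def)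
  have iV: "integrable M (\<lambda>\<omega>. V \<omega> $ j)" for j
    by (rule integrable_bounded[OF VjM Vb])
  have iVa: "integrable M (\<lambda>\<omega>. V \<omega> $ j * a t \<omega> $ j)" for j
  proof (rule integrable_bounded)
    show "\<bar>V \<omega> $ j * a t \<omega> $ j\<bar> \<le> B" if "\<omega> \<in> space M" for \<omega>
      using mult_mono[OF Vb[OF that, of j] ab[OF that, of j]] order_trans[OF abs_ge_zero Vb[OF that, of j]]
      by (simp add: abs_mult)
  qed measurable
  have "expectation (\<lambda>\<omega>. V \<omega> $ j * a t \<omega> $ j) = expectation (\<lambda>\<omega>. V \<omega> $ j * x t $ j)" for j
  proof -
    have "expectation (\<lambda>\<omega>. V \<omega> $ j * a t \<omega> $ j)
        = expectation (\<lambda>\<omega>. V \<omega> $ j * real_cond_exp M ?N (\<lambda>\<omega>. a t \<omega> $ j) \<omega>)"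
      by (rule N.real_cond_exp_intg(2)[symmetric]) (use iVa Vj in auto)
    also have "\<dots> = expectation (\<lambda>\<omega>. V \<omega> $ j * x t $ j)"
    proof (rule integral_cong_AE)
      show "AE \<omega> in M. V \<omega> $ j * real_cond_exp M ?N (\<lambda>\<omega>. a t \<omega> $ j) \<omega> = V \<omega> $ j * x t $ j"
        using a_cond_exp[OF t] by eventually_elim (auto simp: vec_cond_exp_def vec_eq_iff)
    qed auto
    finally show ?thesis .
  qed
  then have "(\<Sum>j\<in>UNIV. expectation (\<lambda>\<omega>. V \<omega> $ j * a t \<omega> $ j - V \<omega> $ j * x t $ j)) = 0"
    using iV iVa by simp
  then show ?thesis
    using iV iVa by (simp add: inner_vec_def right_diff_distrib Bochner_Integration.integral_sum)
qed

text \<open>When \<open>g\<close> is the gradient field of a function, this is the first-order part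
  of its change from \<open>hybrid (t - 1)\<close> to \<open>hybrid t\<close>.\<close>

definition mart_diff :: "(real ^ 'd \<Rightarrow> real ^ 'd) \<Rightarrow> nat \<Rightarrow> 'w \<Rightarrow> real" where
  "mart_diff g t \<omega> = g (hybrid (t - 1) \<omega>) \<bullet> ((1 / real T) *\<^sub>R (a t \<omega> - x t))"

lemma l1_norm_step:
  assumes "t \<in> {1..T}" "\<omega> \<in> space M"
  shows "l1_norm ((1 / real T) *\<^sub>R (a t \<omega> - x t)) \<le> 2 / real T"
  using l1_norm_diff_simplex[OF a_simplex[OF assms] x_simplex[OF assms(1)]]
  by (simp add: l1_norm_scaleR divide_right_mono)

lemma mart_diff_bound:
  assumes g: "\<And>u. infnorm (g u) \<le> c" and t: "t \<in> {1..T}" "\<omega> \<in> space M"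
  shows "\<bar>mart_diff g t \<omega>\<bar> \<le> 2 * c / real T"
proof -
  have c: "0 \<le> c" using g[of 0] infnorm_pos_le[of "g 0"] by linarith
  have "\<bar>mart_diff g t \<omega>\<bar> \<le> infnorm (g (hybrid (t - 1) \<omega>)) * l1_norm ((1 / real T) *\<^sub>R (a t \<omega> - x t))"
    unfolding mart_diff_def by (rule inner_le_infnorm_l1_norm)
  also have "\<dots> \<le> c * (2 / real T)"
    using c by (intro mult_mono g l1_norm_step t l1_norm_nonneg)
  finally show ?thesis by (simp add: mult.commute)
qed

lemma mart_diff_measurable_past:
  assumes g: "continuous_on UNIV g" and st: "1 \<le> s" "s < t"
  shows "mart_diff g s \<in> borel_measurable (past_algebra M a t)"
proof -
  have [measurable]: "g \<in> borel_measurable borel"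
    using g by (rule borel_measurable_continuous_onI)
  have [measurable]: "hybrid (s - 1) \<in> borel_measurable (past_algebra M a t)"
    using st by (intro hybrid_measurable_past) auto
  have [measurable]: "a s \<in> borel_measurable (past_algebra M a t)"
    using st by (intro a_measurable_past) auto
  show ?thesis unfolding mart_diff_def by measurable
qed

lemma hybrid_measurable:
  assumes "k \<le> T"
  shows "hybrid k \<in> borel_measurable M"
proof -
  have "(\<lambda>\<omega>. if s \<le> k then a s \<omega> else x s) \<in> borel_measurable M" if "s \<in> {1..T}" for s
    using a_measurable[of s] that by (cases "s \<le> k") auto
  then show ?thesis unfolding hybrid_def average_def by measurable
qed

lemma mart_diff_measurable:
  assumes g: "continuous_on UNIV g" and t: "t \<in> {1..T}"
  shows "mart_diff g t \<in> borel_measurable M"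
proof -
  have [measurable]: "g \<in> borel_measurable borel"
    using g by (rule borel_measurable_continuous_onI)
  have [measurable]: "hybrid (t - 1) \<in> borel_measurable M" "a t \<in> borel_measurable M"
    using t by (auto intro: hybrid_measurable a_measurable)
  show ?thesis unfolding mart_diff_def by measurable
qed

text \<open>Azuma with \<open>T\<close> increments bounded by \<open>2 * c / T\<close>: the variance
  proxy is \<open>T * (2 * c / T)\<^sup>2\<close>.\<close>

lemma mart_diff_mgf:
  assumes g: "continuous_on UNIV g" "\<And>u. infnorm (g u) \<le> c" and c: "0 < c"
  shows "expectation (\<lambda>\<omega>. exp (\<theta> * (\<Sum>t\<in>{1..T}. mart_diff g t \<omega>))) \<le> exp (\<theta>\<^sup>2 * (4 * c\<^sup>2 / real T) / 2)"
proof -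
  have "expectation (\<lambda>\<omega>. exp (\<theta> * (\<Sum>t\<in>{1..T}. mart_diff g t \<omega>)))
      \<le> exp (\<theta>\<^sup>2 * (real T * (2 * c / real T)\<^sup>2) / 2)"
  proof (rule azuma_mgf)
    fix t assume t: "t \<in> {1..T}"
    \<comment> \<open>The exponential of the earlier differences and the factor \<open>1 / T\<close>
      are absorbed into one bounded vector field measurable in the past, so orthogonality applies to
      it.\<close>
    define V where "V \<omega> = (exp (\<theta> * (\<Sum>s\<in>{1..<t}. mart_diff g s \<omega>)) / real T) *\<^sub>R g (hybrid (t - 1) \<omega>)" for \<omega>
    have "expectation (\<lambda>\<omega>. V \<omega> \<bullet> (a t \<omega> - x t)) = 0"
    proof (rule past_inner_orthogonal[OF t])
      have [measurable]: "g \<in> borel_measurable borel"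
        using g(1) by (rule borel_measurable_continuous_onI)
      have [measurable]: "hybrid (t - 1) \<in> borel_measurable (past_algebra M a t)"
        using t by (intro hybrid_measurable_past) auto
      have [measurable]: "(\<lambda>\<omega>. \<Sum>s\<in>{1..<t}. mart_diff g s \<omega>) \<in> borel_measurable (past_algebra M a t)"
        by (intro borel_measurable_sum mart_diff_measurable_past g) auto
      show "V \<in> borel_measurable (past_algebra M a t)"
        unfolding V_def by measurable
      fix \<omega> assume \<omega>: "\<omega> \<in> space M"
      have "\<bar>\<Sum>s\<in>{1..<t}. mart_diff g s \<omega>\<bar> \<le> (\<Sum>s\<in>{1..<t}. 2 * c / real T)"
        using t \<omega> by (intro order_trans[OF sum_abs sum_mono] mart_diff_bound g) auto
      then have "\<bar>\<theta> * (\<Sum>s\<in>{1..<t}. mart_diff g s \<omega>)\<bar> \<le> \<bar>\<theta>\<bar> * (\<Sum>s\<in>{1..<t}. 2 * c / real T)"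
        unfolding abs_mult by (rule mult_left_mono) simp
      then have "exp (\<theta> * (\<Sum>s\<in>{1..<t}. mart_diff g s \<omega>)) \<le> exp (\<bar>\<theta>\<bar> * (\<Sum>s\<in>{1..<t}. 2 * c / real T))"
        by simp
      then show "infnorm (V \<omega>) \<le> exp (\<bar>\<theta>\<bar> * (\<Sum>s\<in>{1..<t}. 2 * c / real T)) / real T * c"
        unfolding V_def infnorm_mul using g(2)
        by (intro mult_mono infnorm_pos_le) (auto intro!: divide_right_mono)
    qed
    then show "expectation (\<lambda>\<omega>. exp (\<theta> * (\<Sum>s\<in>{1..<t}. mart_diff g s \<omega>)) * mart_diff g t \<omega>) = 0"
      by (simp add: V_def mart_diff_def)
  qed (use g c T_pos in \<open>auto intro!: mart_diff_measurable mart_diff_bound\<close>)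
  also have "real T * (2 * c / real T)\<^sup>2 = 4 * c\<^sup>2 / real T"
    using T_pos by (simp add: power2_eq_square field_simps)
  finally show ?thesis .
qed

text \<open>Telescoping along the hybrids leaves \<open>T\<close> Taylor remainders, each at most
  \<open>K / 2 * (2 / T)\<^sup>2\<close> because a step has l1 norm at most
  \<open>2 / T\<close>.\<close>

lemma mart_diff_sum_approx:
  assumes \<Phi>: "\<And>u h. \<bar>\<Phi> (u + h) - \<Phi> u - g u \<bullet> h\<bar> \<le> K / 2 * (l1_norm h)\<^sup>2"
    and K: "0 \<le> K" and \<omega>: "\<omega> \<in> space M"
  shows "\<bar>\<Phi> (average T (\<lambda>t. a t \<omega>)) - \<Phi> (average T x) - (\<Sum>t\<in>{1..T}. mart_diff g t \<omega>)\<bar> \<le> 2 * K / real T"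
proof -
  have "\<Phi> (average T (\<lambda>t. a t \<omega>)) - \<Phi> (average T x) = (\<Sum>t\<in>{1..T}. \<Phi> (hybrid t \<omega>) - \<Phi> (hybrid (t - 1) \<omega>))"
    using sum_telescope''[of 0 T "\<lambda>t. \<Phi> (hybrid t \<omega>)"]
    by (simp add: hybrid_0 hybrid_T atLeastSucAtMost_greaterThanAtMost[symmetric])
  then have "\<bar>\<Phi> (average T (\<lambda>t. a t \<omega>)) - \<Phi> (average T x) - (\<Sum>t\<in>{1..T}. mart_diff g t \<omega>)\<bar>
      = \<bar>\<Sum>t\<in>{1..T}. \<Phi> (hybrid t \<omega>) - \<Phi> (hybrid (t - 1) \<omega>) - mart_diff g t \<omega>\<bar>"
    by (simp add: sum_subtractf)
  also have "\<dots> \<le> (\<Sum>t\<in>{1..T}. K / 2 * (2 / real T)\<^sup>2)"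
  proof (rule order_trans[OF sum_abs sum_mono])
    fix t assume t: "t \<in> {1..T}"
    let ?h = "(1 / real T) *\<^sub>R (a t \<omega> - x t)"
    have "\<bar>\<Phi> (hybrid t \<omega>) - \<Phi> (hybrid (t - 1) \<omega>) - mart_diff g t \<omega>\<bar> \<le> K / 2 * (l1_norm ?h)\<^sup>2"
      using \<Phi>[of "hybrid (t - 1) \<omega>" ?h] by (simp add: hybrid_step[OF t] mart_diff_def)
    also have "\<dots> \<le> K / 2 * (2 / real T)\<^sup>2"
      using K by (intro mult_left_mono power_mono l1_norm_step t \<omega> l1_norm_nonneg) auto
    finally show "\<bar>\<Phi> (hybrid t \<omega>) - \<Phi> (hybrid (t - 1) \<omega>) - mart_diff g t \<omega>\<bar> \<le> K / 2 * (2 / real T)\<^sup>2" .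
  qed
  also have "\<dots> = 2 * K / real T"
    using T_pos by (simp add: power2_eq_square field_simps)
  finally show ?thesis .
qed

end

section \<open>Difference quotients at scale \<open>\<delta>\<close> and the final estimate\<close>

lemma power2_sum3_le:
  fixes z A B C :: real
  assumes "\<bar>z\<bar> \<le> A + B + \<bar>C\<bar>"
  shows "z\<^sup>2 \<le> 4 * A\<^sup>2 + 4 * B\<^sup>2 + 2 * C\<^sup>2"
proof -
  have "z\<^sup>2 \<le> (A + B + \<bar>C\<bar>)\<^sup>2"
    using power_mono[OF assms, of 2] by simp
  \<comment> \<open>The added squares complete two parallelogram identities, first for
    \<open>A + B\<close> and \<open>\<bar>C\<bar>\<close>, then for \<open>A\<close> and
    \<open>B\<close>. The smaller weight falls on \<open>C\<close>, the martingale term.\<close>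
  also have "\<dots> \<le> (A + B + \<bar>C\<bar>)\<^sup>2 + (A + B - \<bar>C\<bar>)\<^sup>2 + 2 * (A - B)\<^sup>2"
    by simp
  also have "\<dots> = 4 * A\<^sup>2 + 4 * B\<^sup>2 + 2 * C\<^sup>2"
    by (simp add: power2_eq_square algebra_simps)
  finally show ?thesis .
qed

theorem corollary2p8:
  fixes F :: "real ^ 'd \<Rightarrow> real"
    and L\<^sub>0 L\<^sub>1 :: real
    and T :: nat
    and M :: "'w measure"
    and x :: "nat \<Rightarrow> real ^ 'd"
    and a :: "nat \<Rightarrow> 'w \<Rightarrow> real ^ 'd"
  assumes "l1_Lipschitz L\<^sub>0 F"
    and "l1_smooth L\<^sub>1 F"
    and "prob_space M"
    and "1 \<le> T"
    and "\<And>t. t \<in> {1..T} \<Longrightarrow> x t \<in> prob_simplex"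
    and "\<And>t. t \<in> {1..T} \<Longrightarrow> a t \<in> borel_measurable M"
    and "\<And>t \<omega>. t \<in> {1..T} \<Longrightarrow> \<omega> \<in> space M \<Longrightarrow> a t \<omega> \<in> prob_simplex"
    and "\<And>t. t \<in> {1..T} \<Longrightarrow>
           AE \<omega> in M. vec_cond_exp M (past_algebra M a t) (a t) \<omega> = x t"
  shows "(\<integral>\<omega>. (infnorm (gradient F (average T (\<lambda>t. a t \<omega>)) - gradient F (average T x)))\<^sup>2 \<partial>M)
    \<le> 8 * sqrt 2 * L\<^sub>1\<^sup>2 / (real T powr (3 / 2) * sqrt (4 + ln (real CARD('d))))
      + 8 * sqrt 2 * (L\<^sub>0\<^sup>2 + L\<^sub>1\<^sup>2) * sqrt (4 + ln (real CARD('d))) / sqrt (real T)"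
proof -
  interpret simplex_martingale M T x a
    using assms by (simp add: simplex_martingale_def simplex_martingale_axioms_def)
  note smooth = \<open>l1_smooth L\<^sub>1 F\<close>
  let ?G = "gradient F"
  define l where "l = 4 + ln (real CARD('d))"
  define q where "q = sqrt (l / real T)"
  have T: "0 < real T" using T_pos by simp
  have l: "4 \<le> l" by (simp add: l_def)
  have q: "0 < q" "q\<^sup>2 = l / real T" using l T by (simp_all add: q_def)
  have L0: "infnorm (?G u) \<le> L\<^sub>0" for u
    using \<open>l1_Lipschitz L\<^sub>0 F\<close> unfolding l1_Lipschitz_def by blast
  have L0_nonneg: "0 \<le> L\<^sub>0" using L0[of 0] infnorm_pos_le[of "?G 0"] by linarith
  have L1_nonneg: "0 \<le> L\<^sub>1" using smooth by (rule l1_smooth_nonneg)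
  \<comment> \<open>The argument reaches a bound without the factor \<open>sqrt 2\<close>; here it
    is rewritten in terms of \<open>q\<close> and compared with the stated one.\<close>
  have rhs: "8 * (L\<^sub>0\<^sup>2 + L\<^sub>1\<^sup>2) * q + 8 * L\<^sub>1\<^sup>2 / (q * (real T)\<^sup>2)
      \<le> 8 * sqrt 2 * L\<^sub>1\<^sup>2 / (real T powr (3 / 2) * sqrt l) + 8 * sqrt 2 * (L\<^sub>0\<^sup>2 + L\<^sub>1\<^sup>2) * sqrt l / sqrt (real T)"
  proof -
    have "real T powr (3 / 2) = real T powr (1 + 1 / 2)" by simp
    also have "\<dots> = real T * sqrt (real T)"
      using T by (subst powr_add) (simp add: powr_half_sqrt)
    finally have "q * (real T)\<^sup>2 = real T powr (3 / 2) * sqrt l"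
      using T by (simp add: q_def real_sqrt_divide power2_eq_square real_div_sqrt field_simps)
    moreover have "8 * L\<^sub>1\<^sup>2 / (q * (real T)\<^sup>2) \<le> 8 * sqrt 2 * L\<^sub>1\<^sup>2 / (q * (real T)\<^sup>2)"
      using q by (intro divide_right_mono mult_right_mono) auto
    moreover have "8 * (L\<^sub>0\<^sup>2 + L\<^sub>1\<^sup>2) * q \<le> 8 * sqrt 2 * (L\<^sub>0\<^sup>2 + L\<^sub>1\<^sup>2) * q"
      using q by (intro mult_right_mono) auto
    moreover have "8 * sqrt 2 * (L\<^sub>0\<^sup>2 + L\<^sub>1\<^sup>2) * q = 8 * sqrt 2 * (L\<^sub>0\<^sup>2 + L\<^sub>1\<^sup>2) * sqrt l / sqrt (real T)"
      by (simp add: q_def real_sqrt_divide)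
    ultimately show ?thesis by simp
  qed
  have "(\<integral>\<omega>. (infnorm (?G (average T (\<lambda>t. a t \<omega>)) - ?G (average T x)))\<^sup>2 \<partial>M)
      \<le> 8 * (L\<^sub>0\<^sup>2 + L\<^sub>1\<^sup>2) * q + 8 * L\<^sub>1\<^sup>2 / (q * (real T)\<^sup>2)"
  \<comment> \<open>Azuma's bound is applied with \<open>c > 0\<close>, so the case of an
    identically vanishing gradient is split off.\<close>
  proof (cases "L\<^sub>0 = 0")
    case True
    then have "?G u = 0" for u
      using L0[of u] infnorm_pos_le[of "?G u"] infnorm_eq_0[of "?G u"] by simp
    then show ?thesis using q by (simp add: infnorm_0)
  next
    case False
    define \<delta> where "\<delta> = sqrt (2 * q)"
    define c where "c = L\<^sub>0 / \<delta>"
    define K where "K = L\<^sub>1 / \<delta>"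
    define \<Phi> where "\<Phi> j u = (F (u + axis j \<delta>) - F (u - axis j \<delta>)) / (2 * \<delta>)" for j u
    define g where "g j u = (1 / (2 * \<delta>)) *\<^sub>R (?G (u + axis j \<delta>) - ?G (u - axis j \<delta>))" for j u
    define Y where "Y j \<omega> = (\<Sum>t\<in>{1..T}. mart_diff (g j) t \<omega>)" for j \<omega>
    define v where "v = 4 * c\<^sup>2 / real T"
    have \<delta>: "0 < \<delta>" "\<delta>\<^sup>2 = 2 * q" using q by (simp_all add: \<delta>_def)
    have c: "0 < c" using False L0_nonneg \<delta> by (simp add: c_def)
    have K: "0 \<le> K" using L1_nonneg \<delta> by (simp add: K_def)
    have v: "0 < v" using c T by (simp add: v_def)
    have g_cont: "continuous_on UNIV (g j)" for j
      unfolding g_def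
      by (intro continuous_intros continuous_on_compose2[OF l1_smooth_continuous_gradient[OF smooth]]) auto
    have g_bound: "infnorm (g j u) \<le> c" for j u
    proof -
      have "infnorm (?G (u + axis j \<delta>) - ?G (u - axis j \<delta>)) \<le> L\<^sub>0 + L\<^sub>0"
        using infnorm_triangle[of "?G (u + axis j \<delta>)" "- ?G (u - axis j \<delta>)"]
          L0[of "u + axis j \<delta>"] L0[of "u - axis j \<delta>"] by (simp add: infnorm_neg)
      then show ?thesis using \<delta> by (simp add: g_def infnorm_mul c_def del: scaleR_right_diff_distrib) (simp add: field_simps)
    qed
    have \<Phi>_taylor: "\<bar>\<Phi> j (u + h) - \<Phi> j u - g j u \<bullet> h\<bar> \<le> K / 2 * (l1_norm h)\<^sup>2" for j u h
    proof -
      let ?r = "\<lambda>w. F (w + h) - F w - ?G w \<bullet> h"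
      \<comment> \<open>The remainder for \<open>\<Phi> j\<close> is a difference of two remainders
        of \<open>F\<close> with the same increment \<open>h\<close>, at base points shifted by
        \<open>\<delta>\<close> in opposite directions.\<close>
      have eq: "\<Phi> j (u + h) - \<Phi> j u - g j u \<bullet> h = (?r (u + axis j \<delta>) - ?r (u - axis j \<delta>)) / (2 * \<delta>)"
        using \<delta> by (simp add: \<Phi>_def g_def inner_diff_left field_simps)
      have "\<bar>?r (u + axis j \<delta>) - ?r (u - axis j \<delta>)\<bar> \<le> L\<^sub>1 * (l1_norm h)\<^sup>2"
        using l1_smooth_taylor[OF smooth, of "u + axis j \<delta>" h]
          l1_smooth_taylor[OF smooth, of "u - axis j \<delta>" h] by linarith
      from divide_right_mono[OF this, of "2 * \<delta>"] show ?thesis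
        unfolding eq abs_divide using \<delta> by (simp add: K_def mult.commute)
    qed
    have \<Phi>_approx: "\<bar>?G u $ j - \<Phi> j u\<bar> \<le> L\<^sub>1 * \<delta> / 2" for j u
    proof -
      let ?r = "\<lambda>h. F (u + h) - F u - ?G u \<bullet> h"
      \<comment> \<open>In the difference of the remainders for the two opposite increments
        \<open>F u\<close> cancels and the linear parts add up to \<open>2 * \<delta>\<close> times
        the partial derivative.\<close>
      have eq: "?G u $ j - \<Phi> j u = (?r (- axis j \<delta>) - ?r (axis j \<delta>)) / (2 * \<delta>)"
        using \<delta> by (simp add: \<Phi>_def inner_axis field_simps)
      have "\<bar>?r (- axis j \<delta>) - ?r (axis j \<delta>)\<bar> \<le> L\<^sub>1 * \<delta>\<^sup>2"
        using l1_smooth_taylor[OF smooth, of u "axis j \<delta>"]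
          l1_smooth_taylor[OF smooth, of u "- axis j \<delta>"] l1_norm_scaleR[of "-1" "axis j \<delta>"] \<delta>
        by (simp add: l1_norm_axis)
      from divide_right_mono[OF this, of "2 * \<delta>"] show ?thesis
        unfolding eq abs_divide using \<delta>(1) by (simp add: power2_eq_square)
    qed
    have Y_measurable: "Y j \<in> borel_measurable M" for j
      unfolding Y_def by (intro borel_measurable_sum mart_diff_measurable g_cont)
    have Y_bound: "\<bar>Y j \<omega>\<bar> \<le> (\<Sum>t\<in>{1..T}. 2 * c / real T)" if "\<omega> \<in> space M" for j \<omega>
      unfolding Y_def
      by (intro order_trans[OF sum_abs sum_mono] mart_diff_bound g_bound that)
    have Y_mgf: "expectation (\<lambda>\<omega>. exp (\<theta> * Y j \<omega>)) \<le> exp (\<theta>\<^sup>2 * v / 2)" for j \<theta>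
      unfolding Y_def v_def by (rule mart_diff_mgf[OF g_cont g_bound c])
    have Max_int: "integrable M (\<lambda>\<omega>. MAX j. (Y j \<omega>)\<^sup>2)"
      by (rule integrable_Max_square[OF _ _ Y_measurable Y_bound]) auto
    have "(\<integral>\<omega>. (infnorm (?G (average T (\<lambda>t. a t \<omega>)) - ?G (average T x)))\<^sup>2 \<partial>M)
        \<le> (\<integral>\<omega>. 4 * (L\<^sub>1 * \<delta>)\<^sup>2 + 4 * (2 * K / real T)\<^sup>2 + 2 * (MAX j. (Y j \<omega>)\<^sup>2) \<partial>M)"
    \<comment> \<open>This rule takes integrability of the upper bound and its nonnegativity; a
      non-integrable left side would have Bochner integral 0.\<close>
    proof (rule integral_mono')
      fix \<omega> assume \<omega>: "\<omega> \<in> space M"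
      let ?u = "average T (\<lambda>t. a t \<omega>)" and ?w = "average T x"
      \<comment> \<open>The extremal coordinate depends on \<open>\<omega>\<close>, which is why the
        maximum over all \<open>Y j\<close> enters.\<close>
      obtain j where j: "infnorm (?G ?u - ?G ?w) = \<bar>(?G ?u - ?G ?w) $ j\<bar>"
        by (rule infnorm_cart_attained)
      \<comment> \<open>Smoothing costs \<open>L\<^sub>1 * \<delta> / 2\<close> at each of the two
        points, and the exchange along the hybrids costs \<open>2 * K / T\<close>.\<close>
      have "\<bar>(?G ?u - ?G ?w) $ j\<bar> \<le> L\<^sub>1 * \<delta> + 2 * K / real T + \<bar>Y j \<omega>\<bar>"
        using \<Phi>_approx[of ?u j] \<Phi>_approx[of ?w j]
          mart_diff_sum_approx[of "\<Phi> j" "g j" K, OF \<Phi>_taylor K \<omega>, folded Y_def]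
        unfolding vector_minus_component by linarith
      then have "(infnorm (?G ?u - ?G ?w))\<^sup>2 \<le> 4 * (L\<^sub>1 * \<delta>)\<^sup>2 + 4 * (2 * K / real T)\<^sup>2 + 2 * (Y j \<omega>)\<^sup>2"
        unfolding j power2_abs by (rule power2_sum3_le)
      also have "(Y j \<omega>)\<^sup>2 \<le> (MAX j. (Y j \<omega>)\<^sup>2)" by (intro Max_ge) auto
      finally show *: "(infnorm (?G ?u - ?G ?w))\<^sup>2
          \<le> 4 * (L\<^sub>1 * \<delta>)\<^sup>2 + 4 * (2 * K / real T)\<^sup>2 + 2 * (MAX j. (Y j \<omega>)\<^sup>2)" by simp
      show "0 \<le> 4 * (L\<^sub>1 * \<delta>)\<^sup>2 + 4 * (2 * K / real T)\<^sup>2 + 2 * (MAX j. (Y j \<omega>)\<^sup>2)"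
        by (rule order_trans[OF _ *]) simp
    qed (intro Bochner_Integration.integrable_add integrable_mult_right Max_int integrable_const)
    also have "\<dots> = 4 * (L\<^sub>1 * \<delta>)\<^sup>2 + 4 * (2 * K / real T)\<^sup>2 + 2 * expectation (\<lambda>\<omega>. MAX j. (Y j \<omega>)\<^sup>2)"
      using Max_int by (simp add: prob_space)
    also have "\<dots> \<le> 4 * (L\<^sub>1 * \<delta>)\<^sup>2 + 4 * (2 * K / real T)\<^sup>2 + 2 * (2 * v * l)"
    proof -
      have "expectation (\<lambda>\<omega>. MAX j. (Y j \<omega>)\<^sup>2) \<le> 2 * v * (4 + ln (real CARD('d)))"
        by (rule expectation_Max_square_le[OF _ _ Y_measurable Y_bound Y_mgf v]) auto
      then show ?thesis by (simp add: l_def)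
    qed
    \<comment> \<open>With \<open>\<delta>\<^sup>2 = 2 * q\<close> the three summands become
      \<open>8 * L\<^sub>1\<^sup>2 * q\<close>,
      \<open>8 * L\<^sub>1\<^sup>2 / (q * T\<^sup>2)\<close> and
      \<open>8 * L\<^sub>0\<^sup>2 * q\<close>, in this order.\<close>
    also have "\<dots> = 8 * (L\<^sub>0\<^sup>2 + L\<^sub>1\<^sup>2) * q + 8 * L\<^sub>1\<^sup>2 / (q * (real T)\<^sup>2)"
    proof -
      have "l = q\<^sup>2 * real T" using q T by simp
      then have "2 * (2 * v * l) = 16 * L\<^sub>0\<^sup>2 * q\<^sup>2 / \<delta>\<^sup>2"
        using T by (simp add: v_def c_def power_divide)
      also have "\<dots> = 8 * L\<^sub>0\<^sup>2 * q"
        unfolding \<delta>(2) using q(1) by (simp add: power2_eq_square)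
      finally have "2 * (2 * v * l) = 8 * L\<^sub>0\<^sup>2 * q" .
      then show ?thesis
        using \<delta> q T by (simp add: K_def power_mult_distrib power_divide algebra_simps)
    qed
    finally show ?thesis .
  qed
  then show ?thesis using rhs unfolding l_def by linarith
qed

end
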